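(* Let $f:(0,\infty)\to\mathbb{R}$ be a strictly convex function with $f(1)=0$ such that $D_f$ is a finite divergence. Then $A_3(V)>A_2(V)$ for all $V\in(0,1)$.
   Context: For a convex function $f:(0,\infty)\to\mathbb{R}$ with $f(1)=0$, put $f(0):=\lim_{x\downarrow 0}f(x)$ and $f'(\infty):=\lim_{x\uparrow\infty}f(x)/x$ (both exist, possibly $+\infty$). For probability measures $P,Q$ on a common measurable space with densities $p,q$ with respect to a common dominating measure $\lambda$, the $f$-divergence is $D_f(P||Q):=\int_{\{q>0\}} f(p/q)\,dQ+f'(\infty)P\{q=0\}$ (with $\infty\cdot 0=0$), and the total variation distance is $V(P,Q):=\frac12\int|p-q|\,d\lambda$. The divergence $D_f$ is called finite if $\sup_{P,Q}D_f(P||Q)<\infty$, the supremum being over all pairs of probability measures on all possible measurable spaces. For $k\ge1$, $\mathcal{P}_k$ is the set of all probability measures on $\{1,\dots,k\}$, and $A_k(V):=\sup\{D_f(P||Q):P,Q\in\mathcal{P}_k,\ V(P,Q)\le V\}$. *)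

theory Defs
  imports "HOL-Probability.Probability" "HOL-Library.Infinite_Typeclass"
begin

definition strictly_convex_on :: "real set \<Rightarrow> (real \<Rightarrow> real) \<Rightarrow> bool" where
  "strictly_convex_on S f \<longleftrightarrow> convex S \<and>
     (\<forall>x\<in>S. \<forall>y\<in>S. \<forall>t. x \<noteq> y \<longrightarrow> 0 < t \<longrightarrow> t < 1 \<longrightarrow>
        f ((1 - t) * x + t * y) < (1 - t) * f x + t * f y)"

text \<open>
  A function on the open half-line is represented by a total function of type
  \<^typ>\<open>real \<Rightarrow> real\<close> whose values at nonpositive arguments are never used: at \<open>0\<close>
  the limit from the right is taken instead, which may be infinite.
\<close>

definition zero_ext :: "(real \<Rightarrow> real) \<Rightarrow> real \<Rightarrow> ereal" where
  "zero_ext f x = (if x = 0 then Lim (at_right 0) (\<lambda>y. ereal (f y)) else ereal (f x))"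

definition slope_inf :: "(real \<Rightarrow> real) \<Rightarrow> ereal" where
  "slope_inf f = Lim at_top (\<lambda>x. ereal (f x / x))"

text \<open>
  Integral of an extended real function, as positive part minus negative part;
  \<^const>\<open>e2ennreal\<close> maps negative numbers to \<open>0\<close>. In the \<open>f\<close>-divergence of a convex \<open>f\<close>
  the negative part always has a finite integral, since \<open>f\<close> has an affine minorant.
\<close>

definition ereal_integral :: "'a measure \<Rightarrow> ('a \<Rightarrow> ereal) \<Rightarrow> ereal" where
  "ereal_integral M g =
     enn2ereal (\<integral>\<^sup>+x. e2ennreal (g x) \<partial>M) - enn2ereal (\<integral>\<^sup>+x. e2ennreal (- g x) \<partial>M)"

definition dens :: "'a measure \<Rightarrow> 'a measure \<Rightarrow> 'a \<Rightarrow> real" where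
  "dens L P x = enn2real (RN_deriv L P x)"

text \<open>
  \<open>L\<close> is the common dominating measure, relative to which densities are formed. The values
  of the divergence and of the total variation do not depend on its choice.
\<close>

definition f_divergence ::
  "(real \<Rightarrow> real) \<Rightarrow> 'a measure \<Rightarrow> 'a measure \<Rightarrow> 'a measure \<Rightarrow> ereal" where
  "f_divergence f L P Q =
     ereal_integral Q (\<lambda>x. if dens L Q x > 0 then zero_ext f (dens L P x / dens L Q x) else 0)
     + slope_inf f * ereal (measure P {x \<in> space P. dens L Q x = 0})"

definition tot_var :: "'a measure \<Rightarrow> 'a measure \<Rightarrow> 'a measure \<Rightarrow> real" where
  "tot_var L P Q = 1 / 2 * (\<integral>x. \<bar>dens L P x - dens L Q x\<bar> \<partial>L)"

definition dominated_pairs :: "('a measure \<times> 'a measure \<times> 'a measure) set" where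
  "dominated_pairs = {(L, P, Q). sigma_finite_measure L \<and>
     prob_space P \<and> sets P = sets L \<and> absolutely_continuous L P \<and>
     prob_space Q \<and> sets Q = sets L \<and> absolutely_continuous L Q}"

text \<open>
  A single formula cannot quantify over all types, so the universe from which the points of
  the measurable spaces are drawn is a type parameter. The measurable space itself, i.e. the
  carrier set together with its sigma-algebra, ranges over everything inside that universe.
  Every pair \<open>P\<close>, \<open>Q\<close> occurs, because it is dominated by its sum.
\<close>

definition finite_divergence :: "'a itself \<Rightarrow> (real \<Rightarrow> real) \<Rightarrow> bool" where
  "finite_divergence (_ :: 'a itself) f \<longleftrightarrow>
     (SUP (L, P, Q) \<in> (dominated_pairs :: ('a measure \<times> 'a measure \<times> 'a measure) set).
        f_divergence f L P Q) < \<infinity>"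

definition prob_measures :: "nat \<Rightarrow> nat measure set" where
  "prob_measures k = {P. prob_space P \<and> sets P = sets (count_space {1..k})}"

definition max_div :: "(real \<Rightarrow> real) \<Rightarrow> nat \<Rightarrow> real \<Rightarrow> ereal" where
  "max_div f k V =
     (SUP (P, Q) \<in> {(P, Q). P \<in> prob_measures k \<and> Q \<in> prob_measures k \<and>
                            tot_var (count_space {1..k}) P Q \<le> V}.
        f_divergence f (count_space {1..k}) P Q)"

end

theory Submission
  imports Defs
begin

text \<open>
  Let \<open>c\<^sub>0 = f(0)\<close> and \<open>c\<^sub>1 = f'(\<infinity>)\<close>. The slopes \<open>f(x) / \<bar>x - 1\<bar>\<close> strictly increase to
  \<open>c\<^sub>0\<close> as \<open>x\<close> decreases from \<open>1\<close> to \<open>0\<close>, and to \<open>c\<^sub>1\<close> as \<open>x\<close> increases from \<open>1\<close> to \<open>\<infinity>\<close>;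
  finiteness of the divergence, tested on two Dirac measures, makes both limits real.
  On three points the weights \<open>(V, 0, 1 - V)\<close> and \<open>(0, V, 1 - V)\<close> have divergence \<open>V (c\<^sub>0 + c\<^sub>1)\<close>.
  On two points let \<open>(p, 1 - p)\<close> and \<open>(q, 1 - q)\<close> with \<open>q < p\<close> and \<open>v = p - q \<le> V\<close>. The first
  summand of the divergence is \<open>v\<close> times the slope of \<open>f\<close> at \<open>p / q\<close>, the second one is \<open>v\<close> times
  the slope at \<open>(1 - p) / (1 - q)\<close>. Since \<open>q + (1 - p) \<ge> 1 - V\<close>, one of these two arguments
  stays away from \<open>\<infinity>\<close> or from \<open>0\<close>, so that the corresponding slope stays below its limit
  by an amount that depends on \<open>V\<close> only.
\<close>

section \<open>Slopes at 1\<close>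

text \<open>This is strict convexity between \<open>1\<close> and \<open>y\<close>, where the term
  with \<open>f 1\<close> vanishes. Taking for \<open>t\<close> the ratio of two distances to
  \<open>1\<close> gives the monotonicity of the slopes on either side.\<close>

lemma strictly_convex_contract_to_1:
  assumes "strictly_convex_on {0<..} f" "f 1 = 0" "0 < y" "y \<noteq> 1" "0 < t" "t < 1"
  shows "f (1 + t * (y - 1)) < t * f y"
proof -
  have "f ((1 - t) * 1 + t * y) < (1 - t) * f 1 + t * f y"
    using assms unfolding strictly_convex_on_def by (metis greaterThan_iff zero_less_one)
  moreover have "(1 - t) * 1 + t * y = 1 + t * (y - 1)" by (simp add: algebra_simps)
  ultimately show ?thesis using assms(2) by (simp only: mult_zero_right add_0)
qed

lemma strictly_convex_slope_right:
  assumes "strictly_convex_on {0<..} f" "f 1 = 0" "1 < x" "x < y"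
  shows "f x / (x - 1) < f y / (y - 1)"
proof -
  let ?t = "(x - 1) / (y - 1)"
  have "f (1 + ?t * (y - 1)) < ?t * f y"
    using assms by (intro strictly_convex_contract_to_1) auto
  then have "f x < (x - 1) * (f y / (y - 1))" using assms by simp
  then show ?thesis using assms by (simp add: pos_divide_less_eq mult.commute)
qed

lemma strictly_convex_slope_left:
  assumes "strictly_convex_on {0<..} f" "f 1 = 0" "0 < y" "y < x" "x < 1"
  shows "f x / (1 - x) < f y / (1 - y)"
proof -
  let ?t = "(1 - x) / (1 - y)"
  have "f (1 + ?t * (y - 1)) < ?t * f y"
    using assms by (intro strictly_convex_contract_to_1) auto
  moreover have "?t * (y - 1) = x - 1" using assms by (simp add: field_simps)
  ultimately have "f x < (1 - x) * (f y / (1 - y))" by simp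
  then show ?thesis using assms by (simp add: pos_divide_less_eq mult.commute)
qed

text \<open>Monotone convergence along a filter. Comparing \<open>g a\<close> only with eventual
  values of \<open>g\<close> covers growth towards \<open>at_top\<close> and towards
  \<open>at_right 0\<close> alike.\<close>

lemma tendsto_SUP_eventually_mono:
  fixes g :: "'b \<Rightarrow> 'c::{complete_linorder, linorder_topology}"
  assumes "\<forall>\<^sub>F x in F. x \<in> A"
    and "\<And>a. a \<in> A \<Longrightarrow> \<forall>\<^sub>F x in F. g a \<le> g x"
  shows "(g \<longlongrightarrow> (SUP a\<in>A. g a)) F"
proof (rule order_tendstoI)
  fix l assume "l < (SUP a\<in>A. g a)"
  then obtain a where "a \<in> A" "l < g a" by (auto simp: less_SUP_iff)
  then show "\<forall>\<^sub>F x in F. l < g x"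
    using assms(2)[of a] by (auto elim: eventually_mono)
next
  fix u assume u: "(SUP a\<in>A. g a) < u"
  show "\<forall>\<^sub>F x in F. g x < u"
    using assms(1) by eventually_elim (meson SUP_upper le_less_trans u)
qed

text \<open>The quotients \<open>f x / x\<close> and \<open>f x / (x - 1)\<close> differ by the
  factor \<open>(x - 1) / x\<close>, which tends to \<open>1\<close>. The second one is monotone, so
  its limit is its supremum, be it finite or not.\<close>

lemma strictly_convex_slope_inf:
  assumes "strictly_convex_on {0<..} f" "f 1 = 0"
  shows "slope_inf f = (SUP x\<in>{1<..}. ereal (f x / (x - 1)))"
proof -
  let ?L = "SUP x\<in>{1<..}. ereal (f x / (x - 1))"
  have mono: "f a / (a - 1) \<le> f x / (x - 1)" if "1 < a" "a \<le> x" for a x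
    using strictly_convex_slope_right[OF assms, of a x] that by (cases "a = x") auto
  have lim: "((\<lambda>x. ereal (f x / (x - 1))) \<longlongrightarrow> ?L) at_top"
  proof (rule tendsto_SUP_eventually_mono)
    show "\<forall>\<^sub>F x in at_top. x \<in> {1::real<..}" by (simp add: eventually_gt_at_top)
    show "\<forall>\<^sub>F x in at_top. ereal (f a / (a - 1)) \<le> ereal (f x / (x - 1))" if "a \<in> {1<..}" for a
      using eventually_ge_at_top[of a] by eventually_elim (use that mono in auto)
  qed
  have "((\<lambda>x::real. (x - 1) / x) \<longlongrightarrow> 1) at_top" by real_asymp
  then have one: "((\<lambda>x. ereal ((x - 1) / x)) \<longlongrightarrow> ereal 1) at_top" by (rule tendsto_ereal)
  have "((\<lambda>x. ereal ((x - 1) / x) * ereal (f x / (x - 1))) \<longlongrightarrow> ereal 1 * ?L) at_top"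
    by (rule tendsto_mult_ereal[OF one lim]) auto
  moreover have "\<forall>\<^sub>F x in at_top.
      ereal ((x - 1) / x) * ereal (f x / (x - 1)) = ereal (f x / x)"
    using eventually_gt_at_top[of 1] by eventually_elim auto
  ultimately have "((\<lambda>x. ereal (f x / x)) \<longlongrightarrow> ereal 1 * ?L) at_top"
    by (rule Lim_transform_eventually)
  then have "((\<lambda>x. ereal (f x / x)) \<longlongrightarrow> ?L) at_top" by (simp flip: one_ereal_def)
  then show ?thesis unfolding slope_inf_def by (intro tendsto_Lim) auto
qed

lemma strictly_convex_zero_ext_0:
  assumes "strictly_convex_on {0<..} f" "f 1 = 0"
  shows "zero_ext f 0 = (SUP x\<in>{0<..<1}. ereal (f x / (1 - x)))"
proof -
  let ?L = "SUP x\<in>{0<..<1}. ereal (f x / (1 - x))"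
  have mono: "f a / (1 - a) \<le> f x / (1 - x)" if "0 < x" "x \<le> a" "a < 1" for a x
    using strictly_convex_slope_left[OF assms, of x a] that by (cases "a = x") auto
  have lim: "((\<lambda>x. ereal (f x / (1 - x))) \<longlongrightarrow> ?L) (at_right 0)"
  proof (rule tendsto_SUP_eventually_mono)
    show "\<forall>\<^sub>F x in at_right 0. x \<in> {0::real<..<1}"
      by (intro eventually_at_right_real) auto
    show "\<forall>\<^sub>F x in at_right 0. ereal (f a / (1 - a)) \<le> ereal (f x / (1 - x))"
      if "a \<in> {0<..<1}" for a
    proof -
      have "\<forall>\<^sub>F x in at_right 0. x \<in> {0<..<a}" using that by (intro eventually_at_right_real) auto
      then show ?thesis by eventually_elim (use that mono in auto)
    qed
  qed
  have "((\<lambda>x::real. 1 - x) \<longlongrightarrow> 1) (at_right 0)" by real_asymp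
  then have one: "((\<lambda>x. ereal (1 - x)) \<longlongrightarrow> ereal 1) (at_right 0)" by (rule tendsto_ereal)
  \<comment> \<open>The limit \<open>1\<close> of the first factor excludes the indeterminate
    product of \<open>0\<close> and infinity, so \<open>?L\<close> may be infinite here.\<close>
  have "((\<lambda>x. ereal (1 - x) * ereal (f x / (1 - x))) \<longlongrightarrow> ereal 1 * ?L) (at_right 0)"
    by (rule tendsto_mult_ereal[OF one lim]) auto
  moreover have "\<forall>\<^sub>F x in at_right 0. x \<in> {0::real<..<1}"
    by (intro eventually_at_right_real) auto
  then have "\<forall>\<^sub>F x in at_right 0. ereal (1 - x) * ereal (f x / (1 - x)) = ereal (f x)"
    by eventually_elim auto
  ultimately have "((\<lambda>x. ereal (f x)) \<longlongrightarrow> ereal 1 * ?L) (at_right 0)"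
    by (rule Lim_transform_eventually)
  then have "((\<lambda>x. ereal (f x)) \<longlongrightarrow> ?L) (at_right 0)" by (simp flip: one_ereal_def)
  then show ?thesis unfolding zero_ext_def by (simp add: tendsto_Lim)
qed

section \<open>Measures on finite sets\<close>

lemma density_emeasure_singleton:
  assumes "finite S" "sets P = sets (count_space S)"
  shows "density (count_space S) (\<lambda>x. emeasure P {x}) = P"
proof (rule measure_eqI)
  show "sets (density (count_space S) (\<lambda>x. emeasure P {x})) = sets P" using assms by simp
  fix A assume "A \<in> sets (density (count_space S) (\<lambda>x. emeasure P {x}))"
  then have A: "A \<subseteq> S" "finite A" using assms(1) finite_subset by auto
  have "emeasure (density (count_space S) (\<lambda>x. emeasure P {x})) A
      = (\<Sum>x\<in>S. emeasure P {x} * indicator A x)"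
    using A assms by (subst emeasure_density) (auto simp: nn_integral_count_space_finite)
  also have "\<dots> = (\<Sum>x\<in>A. emeasure P {x})"
    using A assms(1) by (subst sum.mono_neutral_right[of S A]) (auto simp: indicator_def)
  also have "\<dots> = emeasure P A"
    using A assms by (intro emeasure_eq_sum_singleton[symmetric]) auto
  finally show "emeasure (density (count_space S) (\<lambda>x. emeasure P {x})) A = emeasure P A" .
qed

text \<open>The point masses are a density with respect to counting measure. Densities are unique
  almost everywhere, which for counting measure means at every point of \<open>S\<close>.\<close>

lemma dens_count_space:
  assumes "finite S" "sets P = sets (count_space S)" "x \<in> S"
  shows "dens (count_space S) P x = measure P {x}"
proof -
  interpret sigma_finite_measure "count_space S"
    using assms(1) by (simp add: sigma_finite_measure_count_space_finite)
  have "AE x in count_space S. emeasure P {x} = RN_deriv (count_space S) P x"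
    by (rule RN_deriv_unique) (simp_all add: density_emeasure_singleton[OF assms(1,2)])
  then show ?thesis using assms(3) by (simp add: AE_count_space dens_def measure_def)
qed

lemma nn_integral_finite_space:
  assumes "finite S" "sets P = sets (count_space S)"
  shows "(\<integral>\<^sup>+x. g x \<partial>P) = (\<Sum>x\<in>S. emeasure P {x} * g x)"
proof -
  have "(\<integral>\<^sup>+x. g x \<partial>P) = (\<integral>\<^sup>+x. g x \<partial>density (count_space S) (\<lambda>x. emeasure P {x}))"
    by (simp add: density_emeasure_singleton[OF assms])
  also have "\<dots> = (\<Sum>x\<in>S. emeasure P {x} * g x)"
    using assms(1) by (subst nn_integral_density) (auto simp: nn_integral_count_space_finite)
  finally show ?thesis .
qed

text \<open>Both parts of the integral are finite sums of reals, so their difference is a real one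
  and recombines point by point.\<close>

lemma ereal_integral_finite_space:
  assumes "finite S" "sets P = sets (count_space S)" "prob_space P"
  shows "ereal_integral P (\<lambda>x. ereal (g x)) = ereal (\<Sum>x\<in>S. measure P {x} * g x)"
proof -
  interpret prob_space P by fact
  have *: "(\<integral>\<^sup>+x. e2ennreal (ereal (h x)) \<partial>P) = ennreal (\<Sum>x\<in>S. measure P {x} * max 0 (h x))"
    for h :: "'a \<Rightarrow> real"
  proof -
    have "(\<integral>\<^sup>+x. e2ennreal (ereal (h x)) \<partial>P) = (\<Sum>x\<in>S. emeasure P {x} * ennreal (h x))"
      by (simp add: nn_integral_finite_space[OF assms(1,2)] ennreal.rep_eq)
    also have "\<dots> = (\<Sum>x\<in>S. ennreal (measure P {x} * max 0 (h x)))"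
      by (intro sum.cong refl)
        (simp add: emeasure_eq_measure ennreal_mult' max_def ennreal_neg)
    finally show ?thesis by (simp add: sum_ennreal)
  qed
  have "ereal_integral P (\<lambda>x. ereal (g x))
      = ereal ((\<Sum>x\<in>S. measure P {x} * max 0 (g x)) - (\<Sum>x\<in>S. measure P {x} * max 0 (- g x)))"
    using *[of g] *[of "\<lambda>x. - g x"] by (simp add: ereal_integral_def enn2ereal_ennreal sum_nonneg)
  also have "\<dots> = ereal (\<Sum>x\<in>S. measure P {x} * g x)"
    by (subst sum_subtractf[symmetric])
      (auto simp: max_def intro!: sum.cong)
  finally show ?thesis .
qed

lemma tot_var_count_space:
  assumes "finite S" "sets P = sets (count_space S)" "sets Q = sets (count_space S)"
  shows "tot_var (count_space S) P Q = 1 / 2 * (\<Sum>x\<in>S. \<bar>measure P {x} - measure Q {x}\<bar>)"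
  using assms by (simp add: tot_var_def lebesgue_integral_count_space_finite dens_count_space)

text \<open>The perspective function of \<open>f\<close>, extended to the boundary with
  \<open>c0\<close> for the limit of \<open>f\<close> at \<open>0\<close> and \<open>c1\<close> for
  its slope at infinity. It is the contribution to the divergence of a point with masses
  \<open>p\<close> and \<open>q\<close>, and vanishes at \<open>p = q = 0\<close>.\<close>

definition perspective :: "(real \<Rightarrow> real) \<Rightarrow> real \<Rightarrow> real \<Rightarrow> real \<Rightarrow> real \<Rightarrow> real" where
  "perspective f c0 c1 p q =
     (if q > 0 then q * (if p = 0 then c0 else f (p / q)) else p * c1)"

lemma f_divergence_count_space:
  assumes S: "finite S" and P: "sets P = sets (count_space S)" "prob_space P"
    and Q: "sets Q = sets (count_space S)" "prob_space Q"
    and c: "zero_ext f 0 = ereal c0" "slope_inf f = ereal c1"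
  shows "f_divergence f (count_space S) P Q
    = ereal (\<Sum>x\<in>S. perspective f c0 c1 (measure P {x}) (measure Q {x}))"
proof -
  interpret P: prob_space P by fact
  let ?p = "\<lambda>x. measure P {x}" and ?q = "\<lambda>x. measure Q {x}"
  let ?g = "\<lambda>x. if ?q x > 0 then if ?p x = 0 then c0 else f (?p x / ?q x) else 0"
  have sp: "space P = S" "space Q = S"
    using sets_eq_imp_space_eq[OF P(1)] sets_eq_imp_space_eq[OF Q(1)] by auto
  have "ereal_integral Q (\<lambda>x. if dens (count_space S) Q x > 0
          then zero_ext f (dens (count_space S) P x / dens (count_space S) Q x) else 0)
      = ereal_integral Q (\<lambda>x. ereal (?g x))"
  proof -
    have "(if dens (count_space S) Q x > 0
          then zero_ext f (dens (count_space S) P x / dens (count_space S) Q x) else 0)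
        = ereal (?g x)" if "x \<in> space Q" for x
      using that c(1) by (auto simp: sp dens_count_space S P Q zero_ext_def)
    then show ?thesis unfolding ereal_integral_def
      by (intro arg_cong2[of _ _ _ _ minus] arg_cong[of _ _ enn2ereal] nn_integral_cong) auto
  qed
  also have "\<dots> = ereal (\<Sum>x\<in>S. ?q x * ?g x)"
    by (rule ereal_integral_finite_space) fact+
  finally have 1: "ereal_integral Q (\<lambda>x. if dens (count_space S) Q x > 0
          then zero_ext f (dens (count_space S) P x / dens (count_space S) Q x) else 0)
      = ereal (\<Sum>x\<in>S. ?q x * ?g x)" .
  have "measure P {x \<in> space P. dens (count_space S) Q x = 0} = measure P {x \<in> S. ?q x = 0}"
    by (rule arg_cong[of _ _ "measure P"]) (auto simp: sp dens_count_space S Q)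
  also have "\<dots> = (\<Sum>x\<in>{x \<in> S. ?q x = 0}. ?p x)"
    using S P(1) by (intro P.finite_measure_eq_sum_singleton) auto
  also have "\<dots> = (\<Sum>x\<in>S. if ?q x = 0 then ?p x else 0)"
    using S by (intro sum.inter_filter)
  finally have 2: "measure P {x \<in> space P. dens (count_space S) Q x = 0}
    = (\<Sum>x\<in>S. if ?q x = 0 then ?p x else 0)" .
  have "(\<Sum>x\<in>S. ?q x * ?g x) + c1 * (\<Sum>x\<in>S. if ?q x = 0 then ?p x else 0)
      = (\<Sum>x\<in>S. perspective f c0 c1 (?p x) (?q x))"
    by (auto simp: sum_distrib_left perspective_def zero_less_measure_iff
        simp flip: sum.distrib intro!: sum.cong)
  then show ?thesis by (simp add: f_divergence_def 1 2 c(2))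
qed

text \<open>At \<open>b\<close> the ratio of the densities is \<open>0\<close>, and all the mass of
  the first measure sits at \<open>a\<close>, where the second density vanishes. The equation is
  stated in \<open>ereal\<close> because it serves to show that the two limits are real.\<close>

lemma f_divergence_return:
  assumes "a \<noteq> b"
  defines "L \<equiv> count_space {a, b}"
  shows "f_divergence f L (return L a) (return L b) = zero_ext f 0 + slope_inf f"
proof -
  have [simp]: "dens L (return L a) b = 0" "dens L (return L b) b = 1" "dens L (return L b) a = 0"
    using assms by (simp_all add: L_def dens_count_space measure_return)
  have "{x \<in> space (return L a). dens L (return L b) x = 0} = {a}"
    using assms(1) by (auto simp: L_def dens_count_space measure_return indicator_def)
  then have "measure (return L a) {x \<in> space (return L a). dens L (return L b) x = 0} = 1"
    by (simp add: L_def measure_return)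
  moreover have "enn2ereal (e2ennreal z) - enn2ereal (e2ennreal (- z)) = z" for z :: ereal
    by (cases "0 \<le> z")
      (auto simp: e2ennreal_neg enn2ereal_e2ennreal zero_ennreal.rep_eq)
  moreover have "ereal_integral (return L b) g
      = enn2ereal (e2ennreal (g b)) - enn2ereal (e2ennreal (- g b))" for g
    unfolding ereal_integral_def
    by (subst (1 2) nn_integral_return) (auto simp: L_def)
  ultimately show ?thesis by (simp add: f_divergence_def flip: one_ereal_def)
qed

lemma finite_divergence_limits:
  assumes "finite_divergence TYPE('a::infinite) f"
  shows "zero_ext f 0 + slope_inf f < \<infinity>"
proof -
  obtain a b :: 'a where ab: "a \<noteq> b"
    \<comment> \<open>Here \<open>undefined\<close> is merely some point, from which a second one is
      chosen to differ.\<close>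
    using ex_new_if_finite[OF infinite_UNIV, of "{undefined}"] by blast
  let ?L = "count_space {a, b}"
  have ac: "absolutely_continuous ?L M" if "sets M = sets ?L" for M :: "'a measure"
    using that by (auto simp: absolutely_continuous_def null_sets_count_space)
  have "(?L, return ?L a, return ?L b) \<in> dominated_pairs"
    by (auto simp: dominated_pairs_def sigma_finite_measure_count_space_finite
        intro!: prob_space_return ac)
  then have "f_divergence f ?L (return ?L a) (return ?L b) \<le>
    (SUP (L, P, Q) \<in> (dominated_pairs :: ('a measure \<times> 'a measure \<times> 'a measure) set).
        f_divergence f L P Q)"
    by (intro SUP_upper2[of "(?L, return ?L a, return ?L b)"]) auto
  then show ?thesis
    using assms unfolding finite_divergence_def f_divergence_return[OF ab] by (rule le_less_trans)
qed

section \<open>Two points against three\<close>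

text \<open>Each limit lies above a real slope, hence is not \<open>-\<infinity>\<close>; as their
  sum is below \<open>\<infinity>\<close>, both are real.\<close>

lemma real_limits_of_finite_divergence:
  assumes "strictly_convex_on {0<..} f" "f 1 = 0"
    and "finite_divergence TYPE('a::infinite) f"
  obtains c0 c1 where "zero_ext f 0 = ereal c0" "slope_inf f = ereal c1"
    "\<And>x. 0 < x \<Longrightarrow> x < 1 \<Longrightarrow> f x / (1 - x) < c0"
    "\<And>x. 1 < x \<Longrightarrow> f x / (x - 1) < c1"
    "0 < c0 + c1"
proof -
  have le0: "ereal (f x / (1 - x)) \<le> zero_ext f 0" if "0 < x" "x < 1" for x
    unfolding strictly_convex_zero_ext_0[OF assms(1,2)] using that by (intro SUP_upper) auto
  have le1: "ereal (f x / (x - 1)) \<le> slope_inf f" if "1 < x" for x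
    unfolding strictly_convex_slope_inf[OF assms(1,2)] using that by (intro SUP_upper) auto
  have "zero_ext f 0 \<noteq> -\<infinity>" "slope_inf f \<noteq> -\<infinity>"
    using le0[of "1/2"] le1[of 2] by auto
  with finite_divergence_limits[OF assms(3)] obtain c0 c1
    where c: "zero_ext f 0 = ereal c0" "slope_inf f = ereal c1"
    by (cases "zero_ext f 0"; cases "slope_inf f") auto
  \<comment> \<open>No slope attains the limit: the slope at \<open>x/2\<close>, further away from
    \<open>1\<close>, is strictly larger and still at most \<open>c0\<close>. The point
    \<open>x+1\<close> plays this role on the other side.\<close>
  have lt0: "f x / (1 - x) < c0" if "0 < x" "x < 1" for x
    using strictly_convex_slope_left[OF assms(1,2), of "x/2" x] le0[of "x/2"] that c by auto
  have lt1: "f x / (x - 1) < c1" if "1 < x" for x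
    using strictly_convex_slope_right[OF assms(1,2), of x "x+1"] le1[of "x+1"] that c by auto
  \<comment> \<open>The midpoint of \<open>1/2\<close> and \<open>3/2\<close> is \<open>1\<close>,
    where \<open>f\<close> vanishes; so the slopes at these two points have a positive sum.\<close>
  have "f ((1 - 1/2) * (1/2) + 1/2 * (3/2)) < (1 - 1/2) * f (1/2) + 1/2 * f (3/2)"
    by (rule assms(1)[unfolded strictly_convex_on_def, THEN conjunct2, rule_format]) auto
  then have "0 < c0 + c1" using lt0[of "1/2"] lt1[of "3/2"] assms(2) by simp
  with c lt0 lt1 that show thesis by blast
qed

text \<open>For \<open>0 < q < p\<close> the left side is \<open>p - q\<close> times the slope at
  \<open>p / q\<close>. For \<open>q = 0\<close> or \<open>p = q\<close> both sides agree.\<close>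

lemma perspective_le_above:
  assumes "f 1 = 0" and lt: "\<And>x. 1 < x \<Longrightarrow> f x / (x - 1) < c1" and "0 \<le> q" "q \<le> p"
  shows "perspective f c0 c1 p q \<le> (p - q) * c1"
proof (cases "0 < q \<and> q < p")
  case True
  then have "perspective f c0 c1 p q = (p - q) * (f (p / q) / (p / q - 1))"
    by (simp add: perspective_def field_simps)
  with True show ?thesis using lt[of "p / q"] by (auto intro!: mult_left_mono simp del: times_divide_eq_right)
qed (use assms in \<open>auto simp: perspective_def\<close>)

lemma perspective_le_below:
  assumes "f 1 = 0" and lt: "\<And>x. 0 < x \<Longrightarrow> x < 1 \<Longrightarrow> f x / (1 - x) < c0"
    and "0 \<le> p" "p \<le> q"
  shows "perspective f c0 c1 p q \<le> (q - p) * c0"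
proof (cases "0 < p \<and> p < q")
  case True
  then have "perspective f c0 c1 p q = (q - p) * (f (p / q) / (1 - p / q))"
    by (simp add: perspective_def field_simps)
  with True show ?thesis using lt[of "p / q"] by (auto intro!: mult_left_mono simp del: times_divide_eq_right)
qed (use assms in \<open>auto simp: perspective_def\<close>)

text \<open>The gap \<open>e\<close> is fixed before \<open>p\<close> and \<open>q\<close>: a strict
  bound for each pair separately could be lost in the supremum.\<close>

lemma two_point_gap:
  assumes f: "strictly_convex_on {0<..} f" "f 1 = 0"
    and lt0: "\<And>x. 0 < x \<Longrightarrow> x < 1 \<Longrightarrow> f x / (1 - x) < c0"
    and lt1: "\<And>x. 1 < x \<Longrightarrow> f x / (x - 1) < c1"
    and V: "0 < V" "V < 1" and pos: "0 < c0 + c1"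
  obtains e where "0 < e"
    "\<And>p q. 0 \<le> q \<Longrightarrow> q \<le> p \<Longrightarrow> p \<le> 1 \<Longrightarrow> p - q \<le> V \<Longrightarrow>
      perspective f c0 c1 p q + perspective f c0 c1 (1 - p) (1 - q) \<le> V * (c0 + c1 - e)"
proof
  define d where "d = (1 - V) / 2"
  define e0 where "e0 = c0 - f d / (1 - d)"
  define e1 where "e1 = c1 - f (1 / d) / (1 / d - 1)"
  \<comment> \<open>Including \<open>c0 + c1\<close> in the minimum keeps the factor
    \<open>c0 + c1 - e\<close> nonnegative, so that \<open>p - q\<close> can be replaced by
    \<open>V\<close> at the end.\<close>
  define e where "e = min (c0 + c1) (min e0 e1)"
  have d: "0 < d" "d < 1" using V by (auto simp: d_def)
  then show "0 < e" using lt0[of d] lt1[of "1 / d"] pos by (simp add: e_def e0_def e1_def)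
  fix p q :: real assume pq: "0 \<le> q" "q \<le> p" "p \<le> 1" "p - q \<le> V"
  let ?a = "perspective f c0 c1 p q" and ?b = "perspective f c0 c1 (1 - p) (1 - q)"
  have a: "?a \<le> (p - q) * c1" using perspective_le_above[of f c1 q p c0] f lt1 pq by auto
  have b: "?b \<le> (p - q) * c0"
    using perspective_le_below[of f c0 "1 - p" "1 - q" c1] f lt0 pq by auto
  have "?a + ?b \<le> (p - q) * (c0 + c1 - e)"
  proof (cases "p = q")
    case True
    with a b show ?thesis by simp
  next
    case False
    then have v: "0 < p - q" using pq by simp
    \<comment> \<open>The sum of \<open>q\<close> and \<open>1 - p\<close> is at least
      \<open>1 - V = 2 * d\<close>. If \<open>d \<le> q\<close>, then
      \<open>p / q \<le> 1 / d\<close>; if \<open>d \<le> 1 - p\<close>, then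
      \<open>(1 - p) / (1 - q) \<ge> d\<close>.\<close>
    have "d \<le> q \<or> d \<le> 1 - p" using pq by (auto simp: d_def)
    then show ?thesis
    proof
      assume q: "d \<le> q"
      have "p / q \<le> 1 / d" using q d pq by (intro frac_le) auto
      then have "f (p / q) / (p / q - 1) \<le> c1 - e1"
        using strictly_convex_slope_right[OF f, of "p / q" "1 / d"] q d v
        by (cases "p / q = 1 / d") (auto simp: e1_def)
      then have "(p - q) * (f (p / q) / (p / q - 1)) \<le> (p - q) * (c1 - e)"
        using v by (intro mult_left_mono) (auto simp: e_def)
      moreover have "?a = (p - q) * (f (p / q) / (p / q - 1))"
        using q d v by (simp add: perspective_def field_simps)
      ultimately show ?thesis using b by (simp add: algebra_simps)
    next
      assume p: "d \<le> 1 - p"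
      let ?x = "(1 - p) / (1 - q)"
      have "d / 1 \<le> ?x" using p d pq v by (intro frac_le) auto
      moreover have "?x < 1" using p d v by simp
      ultimately have "f ?x / (1 - ?x) \<le> c0 - e0"
        using strictly_convex_slope_left[OF f, of d ?x] d
        by (cases "?x = d") (auto simp: e0_def)
      then have "(p - q) * (f ?x / (1 - ?x)) \<le> (p - q) * (c0 - e)"
        using v by (intro mult_left_mono) (auto simp: e_def)
      moreover have "?b = (p - q) * (f ?x / (1 - ?x))"
        using p d v by (simp add: perspective_def field_simps)
      ultimately show ?thesis using a by (simp add: algebra_simps)
    qed
  qed
  also have "\<dots> \<le> V * (c0 + c1 - e)"
    using pq by (intro mult_right_mono) (auto simp: e_def)
  finally show "?a + ?b \<le> V * (c0 + c1 - e)" .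
qed

lemma max_div_2_le:
  assumes c: "zero_ext f 0 = ereal c0" "slope_inf f = ereal c1"
    and bound: "\<And>p q. 0 \<le> q \<Longrightarrow> q \<le> p \<Longrightarrow> p \<le> 1 \<Longrightarrow> p - q \<le> V \<Longrightarrow>
      perspective f c0 c1 p q + perspective f c0 c1 (1 - p) (1 - q) \<le> B"
  shows "max_div f 2 V \<le> ereal B"
  unfolding max_div_def
proof (rule SUP_least, clarify)
  let ?S = "{1..2::nat}"
  fix P Q assume "P \<in> prob_measures 2" "Q \<in> prob_measures 2"
    and TV: "tot_var (count_space ?S) P Q \<le> V"
  then have P: "prob_space P" "sets P = sets (count_space ?S)"
    and Q: "prob_space Q" "sets Q = sets (count_space ?S)"
    by (auto simp: prob_measures_def)
  have S: "?S = {1, 2}" by auto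
  have compl: "measure M {2} = 1 - measure M {1}"
    if "prob_space M" "sets M = sets (count_space ?S)" for M :: "nat measure"
  proof -
    interpret prob_space M by fact
    have "space M = ?S" using sets_eq_imp_space_eq[OF that(2)] by simp
    moreover have "?S - {1} = {2}" by auto
    ultimately show ?thesis using prob_compl[of "{1}"] that(2) by simp
  qed
  define p where "p = measure P {1}"
  define q where "q = measure Q {1}"
  have pq: "0 \<le> p" "p \<le> 1" "0 \<le> q" "q \<le> 1"
    using prob_space.prob_le_1[OF P(1)] prob_space.prob_le_1[OF Q(1)] by (auto simp: p_def q_def)
  \<comment> \<open>Both points contribute \<open>\<bar>p - q\<bar>\<close> to the sum, which
    cancels the factor \<open>1 / 2\<close>.\<close>
  have "\<bar>p - q\<bar> \<le> V"
    using TV unfolding tot_var_count_space[OF finite_atLeastAtMost P(2) Q(2)]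
    by (simp add: S compl[OF P] compl[OF Q] flip: p_def q_def One_nat_def)
  \<comment> \<open>If \<open>p < q\<close>, exchanging the two points leads back to the case
    covered by \<open>bound\<close>.\<close>
  then have "perspective f c0 c1 p q + perspective f c0 c1 (1 - p) (1 - q) \<le> B"
    using bound[of q p] bound[of "1 - q" "1 - p"] pq by (cases "q \<le> p") auto
  then show "f_divergence f (count_space ?S) P Q \<le> ereal B"
    unfolding f_divergence_count_space[OF finite_atLeastAtMost P(2,1) Q(2,1) c]
    by (simp add: S compl[OF P] compl[OF Q] flip: p_def q_def One_nat_def)
qed

text \<open>The third point absorbs the common mass \<open>1 - V\<close> at ratio \<open>1\<close>,
  where \<open>f\<close> vanishes. This leaves the other two points free to carry mass of one
  measure only, contributing exactly \<open>V * c1\<close> and \<open>V * c0\<close>.\<close>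

lemma max_div_3_ge:
  assumes c: "zero_ext f 0 = ereal c0" "slope_inf f = ereal c1"
    and "f 1 = 0" and V: "0 < V" "V < 1"
  shows "ereal (V * (c0 + c1)) \<le> max_div f 3 V"
proof -
  let ?S = "{1..3::nat}"
  define p :: "nat \<Rightarrow> real" where "p = (\<lambda>i. if i = 1 then V else if i = 2 then 0 else 1 - V)"
  define q :: "nat \<Rightarrow> real" where "q = (\<lambda>i. if i = 1 then 0 else if i = 2 then V else 1 - V)"
  define P where "P = point_measure ?S (\<lambda>i. ennreal (p i))"
  define Q where "Q = point_measure ?S (\<lambda>i. ennreal (q i))"
  have S: "?S = {1, 2, 3}" by auto
  have nonneg: "0 \<le> p i" "0 \<le> q i" for i using V by (auto simp: p_def q_def)
  have P: "sets P = sets (count_space ?S)" "prob_space P"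
    using V nonneg unfolding P_def
    by (auto simp: sets_point_measure S p_def simp del: One_nat_def intro!: prob_space_point_measure)
  have Q: "sets Q = sets (count_space ?S)" "prob_space Q"
    using V nonneg unfolding Q_def
    by (auto simp: sets_point_measure S q_def simp del: One_nat_def intro!: prob_space_point_measure)
  have m: "measure P {i} = p i" "measure Q {i} = q i" if "i \<in> ?S" for i
    using that nonneg by (auto simp: P_def Q_def measure_def emeasure_point_measure_finite)
  have "tot_var (count_space ?S) P Q = 1 / 2 * (\<Sum>i\<in>?S. \<bar>p i - q i\<bar>)"
    unfolding tot_var_count_space[OF finite_atLeastAtMost P(1) Q(1)]
    by (simp add: m del: One_nat_def)
  then have "tot_var (count_space ?S) P Q \<le> V"
    using V by (simp add: S p_def q_def del: One_nat_def)
  moreover have "f_divergence f (count_space ?S) P Q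
      = ereal (\<Sum>i\<in>?S. perspective f c0 c1 (p i) (q i))"
    unfolding f_divergence_count_space[OF finite_atLeastAtMost P Q c]
    by (simp add: m del: One_nat_def)
  then have "f_divergence f (count_space ?S) P Q = ereal (V * (c0 + c1))"
    using V assms(3) by (simp add: S p_def q_def perspective_def algebra_simps del: One_nat_def)
  ultimately show ?thesis
    unfolding max_div_def using P Q
    by (intro SUP_upper2[of "(P, Q)"]) (auto simp: prob_measures_def)
qed

theorem mainTheorem4:
  fixes f :: "real \<Rightarrow> real"
  assumes "strictly_convex_on {0<..} f"
    and "f 1 = 0"
    and "finite_divergence TYPE('a::infinite) f"
  shows "\<forall>V::real. 0 < V \<and> V < 1 \<longrightarrow> max_div f 3 V > max_div f 2 V"
proof (intro allI impI, elim conjE)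
  fix V :: real assume V: "0 < V" "V < 1"
  obtain c0 c1 where c: "zero_ext f 0 = ereal c0" "slope_inf f = ereal c1"
    and lt: "\<And>x. 0 < x \<Longrightarrow> x < 1 \<Longrightarrow> f x / (1 - x) < c0" "\<And>x. 1 < x \<Longrightarrow> f x / (x - 1) < c1"
    and pos: "0 < c0 + c1"
    by (rule real_limits_of_finite_divergence[OF assms]) blast
  obtain e where "0 < e" and e: "\<And>p q. 0 \<le> q \<Longrightarrow> q \<le> p \<Longrightarrow> p \<le> 1 \<Longrightarrow> p - q \<le> V \<Longrightarrow>
      perspective f c0 c1 p q + perspective f c0 c1 (1 - p) (1 - q) \<le> V * (c0 + c1 - e)"
    using two_point_gap[OF assms(1,2) lt V pos] by blast
  have "max_div f 2 V \<le> ereal (V * (c0 + c1 - e))" by (rule max_div_2_le[OF c e])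
  also have "\<dots> < ereal (V * (c0 + c1))" using \<open>0 < e\<close> V by simp
  also have "\<dots> \<le> max_div f 3 V" by (rule max_div_3_ge[OF c assms(2) V])
  finally show "max_div f 3 V > max_div f 2 V" .
qed

end
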